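(* Let $G$ be a finite directed acyclic graph with a unique source $s$, a unique sink $t$, inner vertices $[n]=\{1,\dots,n\}$, and no idle edges, satisfying degree equality, and let $\mathcal{R}=\{R_1<\cdots<R_k\}$ be an (ordered) route decomposition of $G$. Then the polytope $Q_{\mathcal{R}}=\varphi(\mathcal{F}_1(G))$ is full-dimensional in the linear subspace of $V^1\times\cdots\times V^n$ given by the intersection of the hyperplanes $\sum_{l\in\mathrm{inlevel}(i)}x^i_l=0$ for all $i\in[n]$. Its facets are given by the half-spaces $$\sum_{i\in[n]}\ \sum_{\substack{R\in\mathcal{R},\\ l\in\mathrm{inlevel}(R^{\mathrm{left}},i)}}x^i_l\ \le\ 1$$ with bounding hyperplanes $$H_M=\Big\{x\in V^1\times\cdots\times V^n\ :\ \sum_{i\in[n]}\ \sum_{\substack{R\in\mathcal{R},\\ l\in\mathrm{inlevel}(R^{\mathrm{left}},i)}}x^i_l=1\Big\},$$ one for each transversal $M=\{e_R:R\in\mathcal{R}\}$ of $\mathcal{R}$ such that for every inner vertex $v$ of $G$ there exists a route of $G$ incident to $v$ that uses no edge of $M$. (The sets $R^{\mathrm{left}}$ depend on $M$.)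
   Context: Directed graphs may have parallel edges. The vertices of $G$ are ordered $s<1<\cdots<n<t$ with every edge from a smaller to a larger vertex. An edge is idle if it is the only incoming or the only outgoing edge of some inner vertex. A route is a directed path from $s$ to $t$ (a sequence of edges). The flow polytope $\mathcal{F}_1(G)$ is the set of $x\in\mathbb{R}_{\ge 0}^{E(G)}$ with inflow equal to outflow at every inner vertex and total outflow $1$ at $s$; equivalently the convex hull of the indicator vectors of routes. Degree equality: $\mathrm{indeg}_G(v)=\mathrm{outdeg}_G(v)$ for all inner $v$. A route decomposition is a set $\mathcal{R}$ of routes whose edge sets partition $E(G)$. A transversal of $\mathcal{R}$ is a set $M=\{e_R:R\in\mathcal{R}\}$ with $e_R\in E(R)$ for each $R\in\mathcal{R}$. For an edge $e$, $\mathrm{label}(e)$ is the index $j$ of the unique $R_j\in\mathcal{R}$ containing $e$. For an inner vertex $i$, $\mathrm{inlevel}(i)$ is the set of labels of the edges entering $i$, and for $D\subseteq E(G)$, $\mathrm{inlevel}(D,i)$ is the set of labels of the edges of $D$ entering $i$. $V^i:=\mathbb{R}^{\mathrm{indeg}(i)}$ has standard basis $\{e^i_l:l\in\mathrm{inlevel}(i)\}$, with corresponding coordinates $x^i_l$. The linear map $\varphi:\mathbb{R}^{E(G)}\to V^1\times\cdots\times V^n$ is defined on the basis vector of an edge $e$ from $i$ to $j$ by $e^j_{\mathrm{label}(e)}-e^i_{\mathrm{label}(e)}$, where the summand for a vertex that is the source or sink is omitted (note that by degree equality the labels of edges leaving $i$ are exactly those of edges entering $i$). Given a transversal $\{e_R\}$,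 for each $R\in\mathcal{R}$ the set $R^{\mathrm{left}}\subseteq E(R)$ consists of the edges that $R$ uses before $e_R$. *)

theory Defs
  imports "HOL-Analysis.Analysis" "HOL-Library.Disjoint_Sets" "Graph_Theory.Arc_Walk"
begin

section \<open>Directed acyclic multigraphs with one source and one sink\<close>

definition inner_verts :: "('v, 'e) pre_digraph \<Rightarrow> 'v \<Rightarrow> 'v \<Rightarrow> 'v set" where
  "inner_verts G s t = verts G - {s, t}"

text \<open>
  The vertex order \<open>s < 1 < \<dots> < n < t\<close> is the order of the vertex type, restricted to
  \<open>verts G\<close>; acyclicity follows from \<open>arc_increasing\<close>. Parallel arcs are allowed.
\<close>

locale flow_dag = fin_digraph G
  for G :: "('v::linorder, 'e) pre_digraph" +
  fixes s t :: 'v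
  assumes source_in_verts: "s \<in> verts G"
    and sink_in_verts: "t \<in> verts G"
    and source_less_sink: "s < t"
    and inner_between: "v \<in> inner_verts G s t \<Longrightarrow> s < v \<and> v < t"
    and arc_increasing: "e \<in> arcs G \<Longrightarrow> tail G e < head G e"
    and unique_source: "v \<in> verts G \<Longrightarrow> in_degree G v = 0 \<longleftrightarrow> v = s"
    and unique_sink: "v \<in> verts G \<Longrightarrow> out_degree G v = 0 \<longleftrightarrow> v = t"

definition idle_arc :: "('v, 'e) pre_digraph \<Rightarrow> 'v \<Rightarrow> 'v \<Rightarrow> 'e \<Rightarrow> bool" where
  "idle_arc G s t e \<longleftrightarrow> (\<exists>v \<in> inner_verts G s t. in_arcs G v = {e} \<or> out_arcs G v = {e})"

definition degree_equality :: "('v, 'e) pre_digraph \<Rightarrow> 'v \<Rightarrow> 'v \<Rightarrow> bool" where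
  "degree_equality G s t \<longleftrightarrow> (\<forall>v \<in> inner_verts G s t. in_degree G v = out_degree G v)"

definition route :: "('v, 'e) pre_digraph \<Rightarrow> 'v \<Rightarrow> 'v \<Rightarrow> 'e list \<Rightarrow> bool" where
  "route G s t p \<longleftrightarrow> pre_digraph.apath G s p t"

text \<open>
  \<open>\<real>\<^sup>E\<close> is the coordinate subspace of \<^typ>\<open>real ^ 'e\<close> of the vectors that vanish outside
  \<open>arcs G\<close>.
\<close>

definition flow_polytope ::
    "('v, 'e::finite) pre_digraph \<Rightarrow> 'v \<Rightarrow> 'v \<Rightarrow> (real ^ 'e) set" where
  "flow_polytope G s t =
     {x. (\<forall>e. e \<notin> arcs G \<longrightarrow> x $ e = 0) \<and>
         (\<forall>e \<in> arcs G. 0 \<le> x $ e) \<and>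
         (\<forall>v \<in> inner_verts G s t. (\<Sum>e \<in> in_arcs G v. x $ e) = (\<Sum>e \<in> out_arcs G v. x $ e)) \<and>
         (\<Sum>e \<in> out_arcs G s. x $ e) = 1}"


section \<open>Route decompositions and transversals\<close>

text \<open>
  An ordered decomposition into \<open>k\<close> routes is a family indexed by a type with \<open>k\<close> elements.
  It is automatically injective: routes are nonempty because \<open>s \<noteq> t\<close>.
\<close>

definition route_decomposition ::
    "('v, 'e) pre_digraph \<Rightarrow> 'v \<Rightarrow> 'v \<Rightarrow> ('l \<Rightarrow> 'e list) \<Rightarrow> bool" where
  "route_decomposition G s t R \<longleftrightarrow>
     (\<forall>l. route G s t (R l)) \<and>
     disjoint_family (\<lambda>l. set (R l)) \<and>
     (\<Union>l. set (R l)) = arcs G"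

definition label :: "('l \<Rightarrow> 'e list) \<Rightarrow> 'e \<Rightarrow> 'l" where
  "label R e = (THE l. e \<in> set (R l))"

definition inlevel ::
    "('v, 'e) pre_digraph \<Rightarrow> ('l \<Rightarrow> 'e list) \<Rightarrow> 'e set \<Rightarrow> 'v \<Rightarrow> 'l set" where
  "inlevel G R D i = label R ` (D \<inter> in_arcs G i)"

definition transversal :: "('l \<Rightarrow> 'e list) \<Rightarrow> 'e set \<Rightarrow> bool" where
  "transversal R M \<longleftrightarrow> (\<exists>c. (\<forall>l. c l \<in> set (R l)) \<and> M = range c)"

text \<open>
  As the routes are arc-disjoint, a transversal \<open>M\<close> meets each of them in exactly one arc,
  so that arc can be recovered from \<open>M\<close>.
\<close>

definition chosen_arc :: "('l \<Rightarrow> 'e list) \<Rightarrow> 'e set \<Rightarrow> 'l \<Rightarrow> 'e" where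
  "chosen_arc R M r = (THE e. e \<in> M \<and> e \<in> set (R r))"

definition left_arcs :: "('l \<Rightarrow> 'e list) \<Rightarrow> 'e set \<Rightarrow> 'l \<Rightarrow> 'e set" where
  "left_arcs R M r = set (takeWhile (\<lambda>e. e \<noteq> chosen_arc R M r) (R r))"

definition avoidable ::
    "('v, 'e) pre_digraph \<Rightarrow> 'v \<Rightarrow> 'v \<Rightarrow> 'e set \<Rightarrow> bool" where
  "avoidable G s t M \<longleftrightarrow>
     (\<forall>v \<in> inner_verts G s t. \<exists>p. route G s t p \<and>
        v \<in> set (pre_digraph.awalk_verts G s p) \<and> set p \<inter> M = {})"


section \<open>The projected flow polytope\<close>

text \<open>
  The coordinate \<open>x\<^sup>i\<^sub>l\<close> is \<open>x $ i $ l\<close>. The product \<open>V\<^sup>1 \<times> \<dots> \<times> V\<^sup>n\<close> is the coordinate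
  subspace of \<^typ>\<open>real ^ 'l ^ 'v\<close> in which only the coordinates with \<open>i\<close> an inner vertex and
  \<open>l \<in> inlevel(i)\<close> can be nonzero.
\<close>

definition level_space ::
    "('v::finite, 'e) pre_digraph \<Rightarrow> 'v \<Rightarrow> 'v \<Rightarrow> ('l::finite \<Rightarrow> 'e list) \<Rightarrow>
     (real ^ 'l ^ 'v) set" where
  "level_space G s t R =
     {x. \<forall>i l. \<not> (i \<in> inner_verts G s t \<and> l \<in> inlevel G R (arcs G) i) \<longrightarrow> x $ i $ l = 0}"

definition level_vec ::
    "('v::finite, 'e) pre_digraph \<Rightarrow> 'v \<Rightarrow> 'v \<Rightarrow> 'v \<Rightarrow> 'l::finite \<Rightarrow> real ^ 'l ^ 'v" where
  "level_vec G s t i l = (if i \<in> inner_verts G s t then axis i (axis l 1) else 0)"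

definition level_map ::
    "('v::finite, 'e::finite) pre_digraph \<Rightarrow> 'v \<Rightarrow> 'v \<Rightarrow> ('l::finite \<Rightarrow> 'e list) \<Rightarrow>
     real ^ 'e \<Rightarrow> real ^ 'l ^ 'v" where
  "level_map G s t R x =
     (\<Sum>e \<in> arcs G. x $ e *\<^sub>R
        (level_vec G s t (head G e) (label R e) - level_vec G s t (tail G e) (label R e)))"

definition Q_polytope ::
    "('v::finite, 'e::finite) pre_digraph \<Rightarrow> 'v \<Rightarrow> 'v \<Rightarrow> ('l::finite \<Rightarrow> 'e list) \<Rightarrow>
     (real ^ 'l ^ 'v) set" where
  "Q_polytope G s t R = level_map G s t R ` flow_polytope G s t"

definition zero_sum_space ::
    "('v::finite, 'e) pre_digraph \<Rightarrow> 'v \<Rightarrow> 'v \<Rightarrow> ('l::finite \<Rightarrow> 'e list) \<Rightarrow>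
     (real ^ 'l ^ 'v) set" where
  "zero_sum_space G s t R =
     {x \<in> level_space G s t R.
        \<forall>i \<in> inner_verts G s t. (\<Sum>l \<in> inlevel G R (arcs G) i. x $ i $ l) = 0}"

definition left_sum ::
    "('v::finite, 'e) pre_digraph \<Rightarrow> 'v \<Rightarrow> 'v \<Rightarrow> ('l::finite \<Rightarrow> 'e list) \<Rightarrow> 'e set \<Rightarrow>
     real ^ 'l ^ 'v \<Rightarrow> real" where
  "left_sum G s t R M x =
     (\<Sum>i \<in> inner_verts G s t. \<Sum>r \<in> UNIV. \<Sum>l \<in> inlevel G R (left_arcs R M r) i. x $ i $ l)"

definition halfspace_M ::
    "('v::finite, 'e) pre_digraph \<Rightarrow> 'v \<Rightarrow> 'v \<Rightarrow> ('l::finite \<Rightarrow> 'e list) \<Rightarrow> 'e set \<Rightarrow>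
     (real ^ 'l ^ 'v) set" where
  "halfspace_M G s t R M = {x \<in> level_space G s t R. left_sum G s t R M x \<le> 1}"

definition hyperplane_M ::
    "('v::finite, 'e) pre_digraph \<Rightarrow> 'v \<Rightarrow> 'v \<Rightarrow> ('l::finite \<Rightarrow> 'e list) \<Rightarrow> 'e set \<Rightarrow>
     (real ^ 'l ^ 'v) set" where
  "hyperplane_M G s t R M = {x \<in> level_space G s t R. left_sum G s t R M x = 1}"

end

theory Submission
  imports Defs
begin

text \<open>
  Along \<open>R\<^sub>l\<close> the coordinates of \<open>\<phi>(x)\<close> are the successive differences of \<open>x\<close>. Given \<open>z\<close> in the
  zero-sum space, let \<open>S\<^sub>l(e, z)\<close> be the sum of the coordinates of \<open>z\<close> along \<open>R\<^sub>l\<close> before the arc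
  \<open>e\<close>. The preimages of \<open>z\<close> with total flow \<open>1\<close> are \<open>x\<^sub>e = a\<^sub>l - S\<^sub>l(e, z)\<close> for \<open>e\<close> on \<open>R\<^sub>l\<close>, with free
  starting values \<open>a\<^sub>l\<close> of sum \<open>1\<close>, and one of them is nonnegative iff the maxima over \<open>e\<close> of
  \<open>S\<^sub>l(e, z)\<close> add up to at most \<open>1\<close>. This is the system of all inequalities
  \<open>\<Sum>\<^sub>l S\<^sub>l(e\<^sub>l, z) \<le> 1\<close> over transversals \<open>M = {e\<^sub>l}\<close>, and on \<open>z = \<phi>(x)\<close> the left-hand side is
  \<open>1 - x(M)\<close>.

  If every inner vertex is on a route avoiding \<open>M\<close>, splicing these routes gives one through every
  arc outside \<open>M\<close>; their average is tight for \<open>M\<close> and for no other transversal, so \<open>M\<close> defines a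
  facet. If \<open>v\<close> is on no such route, a flow that vanishes on \<open>M\<close> vanishes at \<open>v\<close>, so the face of
  \<open>M\<close> lies in the linear subspace \<open>x\<^sup>v = 0\<close>, which is proper as there are no idle arcs; the span of
  a facet would be the whole space.
\<close>


section \<open>Facets of a polyhedron with the origin in its relative interior\<close>

text \<open>Each strict inequality survives for all sufficiently small positive \<epsilon>, and
  finitely many such conditions eventually hold together.\<close>

lemma finite_strict_slack:
  fixes a b :: "'i \<Rightarrow> real"
  assumes "finite J" "\<And>i. i \<in> J \<Longrightarrow> a i < c"
  shows "\<exists>\<epsilon>>0. \<forall>i\<in>J. a i + \<epsilon> * b i \<le> c"
proof -
  have "\<forall>\<^sub>F \<epsilon> in at_right 0. \<forall>i\<in>J. a i + \<epsilon> * b i < c"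
  proof (rule eventually_ball_finite[OF assms(1)], rule ballI)
    fix i assume "i \<in> J"
    have "((\<lambda>\<epsilon>. a i + \<epsilon> * b i) \<longlongrightarrow> a i + 0 * b i) (at_right 0)"
      by (intro tendsto_intros)
    then show "\<forall>\<^sub>F \<epsilon> in at_right 0. a i + \<epsilon> * b i < c"
      using assms(2)[OF \<open>i \<in> J\<close>] by (auto intro: order_tendstoD)
  qed
  with eventually_at_right_less[of "0::real"]
  have "\<forall>\<^sub>F \<epsilon> in at_right 0. 0 < \<epsilon> \<and> (\<forall>i\<in>J. a i + \<epsilon> * b i < c)"
    by (rule eventually_conj)
  then obtain \<epsilon> where "0 < \<epsilon>" "\<forall>i\<in>J. a i + \<epsilon> * b i < c"
    using eventually_happens[of _ "at_right (0::real)"] by auto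
  then show ?thesis by force
qed

text \<open>All right-hand sides are normalised to 1, so the origin satisfies every inequality
  strictly. Inside \<open>Z\<close>, the set \<open>polar\<close> is the polar of the finite family
  of functionals \<open>f i\<close>.\<close>

locale polar_polyhedron =
  fixes Z :: "'a::euclidean_space set" and I :: "'i set" and f :: "'i \<Rightarrow> 'a \<Rightarrow> real"
  assumes subspace_Z: "subspace Z"
    and finite_I: "finite I"
    and linear_f: "i \<in> I \<Longrightarrow> linear (f i)"
begin

definition polar :: "'a set" where
  "polar = {z \<in> Z. \<forall>i \<in> I. f i z \<le> 1}"

lemma polarD: "z \<in> polar \<Longrightarrow> z \<in> Z" "z \<in> polar \<Longrightarrow> i \<in> I \<Longrightarrow> f i z \<le> 1"
  by (auto simp: polar_def)

lemma f_add: "i \<in> I \<Longrightarrow> f i (x + c *\<^sub>R y) = f i x + c * f i y"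
  by (simp add: linear_f linear_add linear_cmul)

lemma f_zero: "i \<in> I \<Longrightarrow> f i 0 = 0"
  by (simp add: linear_f linear_0)

lemma f_inner: "i \<in> I \<Longrightarrow> \<exists>a. \<forall>x. f i x = a \<bullet> x"
  using adjoint_works[OF linear_f, of i _ 1] by (metis inner_commute inner_real_def mult.right_neutral)

lemma zero_in_polar: "0 \<in> polar"
  by (simp add: polar_def f_zero subspace_0 subspace_Z)

lemma convex_polar: "convex polar"
proof -
  have "convex (f i -` {..1})" if "i \<in> I" for i
    using convex_linear_vimage[OF linear_f[OF that] convex_real_interval(2)] .
  then have "convex (Z \<inter> (\<Inter>i\<in>I. f i -` {..1}))"
    by (rule convex_Int[OF subspace_imp_convex[OF subspace_Z] convex_INT])
  moreover have "Z \<inter> (\<Inter>i\<in>I. f i -` {..1}) = polar"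
    by (auto simp: polar_def)
  ultimately show ?thesis by simp
qed

text \<open>Constraints that are slack at \<open>p\<close> tolerate a short step in any direction,
  and tight ones do not grow along \<open>z\<close>. At the origin nothing is tight, so every
  direction of \<open>Z\<close> is allowed there.\<close>

lemma move_in_polar:
  assumes "p \<in> polar" "z \<in> Z" "\<And>i. i \<in> I \<Longrightarrow> f i p = 1 \<Longrightarrow> f i z \<le> 0"
  obtains \<epsilon> where "\<epsilon> > 0" "p + \<epsilon> *\<^sub>R z \<in> polar"
proof -
  have "\<exists>\<epsilon>>0. \<forall>i\<in>{i \<in> I. f i p < 1}. f i p + \<epsilon> * f i z \<le> 1"
    by (rule finite_strict_slack) (simp_all add: finite_I)
  then obtain \<epsilon> where \<epsilon>: "\<epsilon> > 0" "\<And>i. i \<in> I \<Longrightarrow> f i p < 1 \<Longrightarrow> f i p + \<epsilon> * f i z \<le> 1"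
    by blast
  have "f i (p + \<epsilon> *\<^sub>R z) \<le> 1" if i: "i \<in> I" for i
  proof (cases "f i p = 1")
    case True
    with assms(3)[OF i] \<epsilon>(1) show ?thesis by (simp add: f_add i mult_nonneg_nonpos)
  next
    case False
    with polarD(2)[OF assms(1) i] \<epsilon>(2)[of i] i show ?thesis by (simp add: f_add)
  qed
  moreover have "p + \<epsilon> *\<^sub>R z \<in> Z"
    using assms polarD(1) subspace_Z by (simp add: subspace_add subspace_scale)
  ultimately show thesis using that \<epsilon>(1) by (simp add: polar_def)
qed

text \<open>A positive multiple of every vector of \<open>Z\<close> lies in \<open>polar\<close>,
  which therefore spans \<open>Z\<close>; as \<open>polar\<close> contains the origin, affine and
  linear dimension agree.\<close>

lemma aff_dim_polar: "aff_dim polar = int (dim Z)"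
proof -
  have "Z \<subseteq> span polar"
  proof
    fix z assume "z \<in> Z"
    then obtain \<epsilon> where \<epsilon>: "\<epsilon> > 0" "0 + \<epsilon> *\<^sub>R z \<in> polar"
      using move_in_polar[OF zero_in_polar, of z] by (auto simp: f_zero)
    then have "(1 / \<epsilon>) *\<^sub>R (\<epsilon> *\<^sub>R z) \<in> span polar"
      by (intro span_scale span_base) simp
    with \<epsilon>(1) show "z \<in> span polar" by simp
  qed
  then have "dim Z = dim polar"
    using polarD(1) by (intro antisym dim_subset dim_mono) auto
  then show ?thesis
    by (simp add: aff_dim_zero hull_inc zero_in_polar)
qed

text \<open>If nothing were tight at \<open>z\<close>, the segment from any \<open>w\<close> in
  \<open>polar\<close> to \<open>z\<close> could be prolonged beyond \<open>z\<close> inside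
  \<open>polar\<close>. The face would then contain \<open>w\<close>, hence be all of
  \<open>polar\<close>.\<close>

lemma proper_face_tight:
  assumes F: "F face_of polar" "F \<noteq> polar" and z: "z \<in> F"
  shows "\<exists>i\<in>I. f i z = 1"
proof (rule ccontr)
  assume "\<not> ?thesis"
  then have slack: "f i z \<noteq> 1" if "i \<in> I" for i using that by blast
  have zP: "z \<in> polar" using face_of_imp_subset[OF F(1)] z by blast
  have "polar \<subseteq> F"
  proof
    fix w assume w: "w \<in> polar"
    have "z - w \<in> Z" using zP w polarD(1) subspace_Z by (simp add: subspace_diff)
    then obtain \<epsilon> where \<epsilon>: "\<epsilon> > 0" and y: "z + \<epsilon> *\<^sub>R (z - w) \<in> polar"
      using move_in_polar[OF zP, of "z - w"] slack by blast
    show "w \<in> F"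
    proof (cases "w = z")
      case False
      have "z \<in> open_segment (z + \<epsilon> *\<^sub>R (z - w)) w"
        unfolding in_segment
      proof (intro conjI exI)
        show "z = (1 - \<epsilon> / (1 + \<epsilon>)) *\<^sub>R (z + \<epsilon> *\<^sub>R (z - w)) + (\<epsilon> / (1 + \<epsilon>)) *\<^sub>R w"
        proof -
          have 1: "1 - \<epsilon> / (1 + \<epsilon>) = 1 / (1 + \<epsilon>)" using \<epsilon> by (simp add: field_simps)
          have "(1 + \<epsilon>) *\<^sub>R z = (z + \<epsilon> *\<^sub>R (z - w)) + \<epsilon> *\<^sub>R w"
            by (simp add: algebra_simps)
          then have "(1 / (1 + \<epsilon>)) *\<^sub>R ((1 + \<epsilon>) *\<^sub>R z)
              = (1 / (1 + \<epsilon>)) *\<^sub>R ((z + \<epsilon> *\<^sub>R (z - w)) + \<epsilon> *\<^sub>R w)" by simp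
          then show ?thesis using \<epsilon> unfolding 1 by (simp add: scaleR_add_right)
        qed
        have "z + \<epsilon> *\<^sub>R (z - w) - w = (1 + \<epsilon>) *\<^sub>R (z - w)" by (simp add: algebra_simps)
        with False \<epsilon> show "z + \<epsilon> *\<^sub>R (z - w) \<noteq> w" by force
      qed (use \<epsilon> in auto)
      then show ?thesis using F(1) y w z unfolding face_of_def by blast
    qed (use z in simp)
  qed
  with F face_of_imp_subset show False by blast
qed

section \<open>Faces cut out by single constraints, and facets\<close>

definition face :: "'i \<Rightarrow> 'a set" where
  "face i = polar \<inter> {x. f i x = 1}"

lemma face_face_of:
  assumes "i \<in> I"
  shows "face i face_of polar"
proof -
  obtain a where a: "\<And>x. f i x = a \<bullet> x"
    using f_inner[OF assms] by metis
  have "polar \<inter> {x. a \<bullet> x = 1} face_of polar"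
    by (rule face_of_Int_supporting_hyperplane_le[OF convex_polar])
      (use polarD(2)[OF _ assms] in \<open>simp add: a[symmetric]\<close>)
  then show ?thesis
    by (simp only: face_def a)
qed

lemma zero_notin_hull_face:
  assumes "i \<in> I"
  shows "0 \<notin> affine hull (face i)"
proof -
  obtain a where a: "\<And>x. f i x = a \<bullet> x"
    using f_inner[OF assms] by metis
  have "affine {x. a \<bullet> x = 1}" by (rule affine_hyperplane)
  then have "affine hull (face i) \<subseteq> {x. a \<bullet> x = 1}"
    by (rule hull_minimal[rotated]) (auto simp: face_def a)
  then show ?thesis by force
qed

text \<open>The affine hull of the face misses the origin, so adjoining the origin adds exactly one
  affine dimension while leaving the span unchanged.\<close>

lemma dim_face:
  assumes "i \<in> I"
  shows "int (dim (face i)) = aff_dim (face i) + 1"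
proof -
  have "int (dim (face i)) = int (dim (insert 0 (face i)))" by (simp add: dim_insert span_zero)
  also have "\<dots> = aff_dim (insert 0 (face i))" by (simp add: aff_dim_zero hull_inc)
  finally show ?thesis using zero_notin_hull_face[OF assms] by (simp add: aff_dim_insert)
qed

text \<open>
  As \<open>0\<close> lies off the supporting hyperplane, a nonempty face is a facet iff it spans \<open>Z\<close>.
\<close>

lemma facet_iff_spanning:
  assumes "i \<in> I"
  shows "face i facet_of polar \<longleftrightarrow> face i \<noteq> {} \<and> Z \<subseteq> span (face i)"
proof -
  have sub: "face i \<subseteq> Z" using polarD(1) by (auto simp: face_def)
  have "face i facet_of polar \<longleftrightarrow> face i \<noteq> {} \<and> dim (face i) = dim Z"
    using dim_face[OF assms] face_face_of[OF assms] by (auto simp: facet_of_def aff_dim_polar)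
  also have "dim (face i) = dim Z \<longleftrightarrow> Z \<subseteq> span (face i)"
  proof
    assume "dim (face i) = dim Z"
    then have "span (face i) = span Z"
      using sub by (intro dim_eq_span) auto
    then show "Z \<subseteq> span (face i)" by (simp add: span_superset)
  next
    assume "Z \<subseteq> span (face i)"
    then show "dim (face i) = dim Z"
      using sub by (intro antisym dim_subset dim_mono)
  qed
  finally show ?thesis .
qed

text \<open>A point tight for \<open>i\<close> alone makes \<open>face i\<close> a facet and tells
  it apart from the faces of other indices. Conversely, every facet equals some
  \<open>face i\<close>, found by \<open>proper_face_tight\<close>, and \<open>inessential\<close>
  rules out indices outside \<open>A\<close>, whose faces cannot span \<open>Z\<close>.\<close>

lemma bij_betw_facets:
  assumes "A \<subseteq> I"
    and essential: "\<And>i. i \<in> A \<Longrightarrow> \<exists>p \<in> face i. \<forall>j \<in> I - {i}. f j p < 1"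
    and inessential: "\<And>i. i \<in> I - A \<Longrightarrow> \<exists>W. subspace W \<and> \<not> Z \<subseteq> W \<and> face i \<subseteq> W"
  shows "bij_betw face A {F. F facet_of polar}"
  unfolding bij_betw_def
proof
  show "inj_on face A"
  proof
    fix i j assume ij: "i \<in> A" "j \<in> A" "face i = face j"
    obtain p where p: "p \<in> face i" "\<forall>j \<in> I - {i}. f j p < 1" using essential[OF ij(1)] by blast
    then have "f j p = 1" using ij(3) by (auto simp: face_def)
    then show "i = j" using p(2) ij(2) \<open>A \<subseteq> I\<close> by force
  qed
  have facet: "face i facet_of polar" if i: "i \<in> A" for i
  proof -
    obtain p where p: "p \<in> face i" "\<And>j. j \<in> I \<Longrightarrow> j \<noteq> i \<Longrightarrow> f j p < 1" using essential[OF i] by blast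
    have iI: "i \<in> I" and pP: "p \<in> polar" and fp: "f i p = 1" using i \<open>A \<subseteq> I\<close> p(1) by (auto simp: face_def)
    have "z \<in> span (face i)" if z: "z \<in> Z" for z
    proof -
      \<comment> \<open>\<open>w\<close> is \<open>z\<close> shifted along \<open>p\<close> into the
        kernel of \<open>f i\<close>, so a short step from \<open>p\<close> along \<open>w\<close>
        stays in \<open>face i\<close>; the difference of two points of the face then recovers
        \<open>w\<close>.\<close>
      define w where "w = z + (- f i z) *\<^sub>R p"
      have w: "w \<in> Z"
        unfolding w_def using z pP polarD(1) subspace_Z by (intro subspace_add subspace_scale) auto
      have fw: "f i w = 0" unfolding w_def f_add[OF iI] by (simp add: fp)
      obtain \<epsilon> where \<epsilon>: "\<epsilon> > 0" "p + \<epsilon> *\<^sub>R w \<in> polar"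
        using move_in_polar[OF pP w] fw p(2) by (metis less_irrefl order_refl)
      then have q: "p + \<epsilon> *\<^sub>R w \<in> face i" by (simp add: face_def f_add[OF iI] fp fw)
      have "(1 / \<epsilon>) *\<^sub>R ((p + \<epsilon> *\<^sub>R w) - p) + f i z *\<^sub>R p \<in> span (face i)"
        using q p(1) by (intro span_add span_scale span_diff span_base)
      then show ?thesis using \<epsilon>(1) by (simp add: w_def)
    qed
    then show ?thesis using facet_iff_spanning[OF iI] p(1) by blast
  qed
  moreover have "F \<in> face ` A" if F: "F facet_of polar" for F
  proof -
    have face: "F face_of polar" and ne: "F \<noteq> {}" and dimF: "aff_dim F = aff_dim polar - 1"
      using F by (auto simp: facet_of_def)
    have "F \<noteq> polar" using dimF by auto
    have "convex F" using face by (rule face_of_imp_convex)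
    \<comment> \<open>The point is taken in the relative interior because a face of
      \<open>polar\<close> that contains such a point contains all of \<open>F\<close>.\<close>
    then obtain z where z: "z \<in> rel_interior F" using ne rel_interior_eq_empty by blast
    then have "z \<in> F" using rel_interior_subset by blast
    then obtain i where i: "i \<in> I" "f i z = 1"
      using proper_face_tight[OF face \<open>F \<noteq> polar\<close>] by blast
    have FP: "F \<subseteq> polar" using face by (rule face_of_imp_subset)
    have "F \<subseteq> face i"
    proof (rule subset_of_face_of[OF face_face_of[OF i(1)] FP])
      show "face i \<inter> rel_interior F \<noteq> {}" using z i(2) FP \<open>z \<in> F\<close> by (auto simp: face_def)
    qed
    have "0 \<notin> face i" using zero_notin_hull_face[OF i(1)] by (meson hull_inc)
    then have "face i \<noteq> polar" using zero_in_polar by blast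
    then have lt: "aff_dim (face i) < aff_dim polar"
      by (rule face_of_aff_dim_lt[OF convex_polar face_face_of[OF i(1)]])
    \<comment> \<open>\<open>F\<close> has codimension 1 and \<open>face i\<close> is a proper face,
      so the dimensions leave no room for a strict inclusion.\<close>
    have eq: "F = face i"
    proof (rule ccontr)
      assume "F \<noteq> face i"
      have "F face_of face i"
        using face \<open>F \<subseteq> face i\<close> face_of_imp_subset[OF face_face_of[OF i(1)]] by (rule face_of_subset)
      then have "aff_dim F < aff_dim (face i)"
        using \<open>F \<noteq> face i\<close> face_of_aff_dim_lt face_of_imp_convex[OF face_face_of[OF i(1)]] by blast
      with lt dimF show False by simp
    qed
    have "i \<in> A"
    proof (rule ccontr)
      assume "i \<notin> A"
      then obtain W where W: "subspace W" "\<not> Z \<subseteq> W" "face i \<subseteq> W" using inessential[of i] i(1) by blast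
      have "Z \<subseteq> span (face i)" using F eq facet_iff_spanning[OF i(1)] by blast
      also have "\<dots> \<subseteq> W" using W by (simp add: span_minimal)
      finally show False using W(2) by blast
    qed
    with eq show ?thesis by blast
  qed
  ultimately show "face ` A = {F. F facet_of polar}" by blast
qed

end


section \<open>Walks and flows\<close>

text \<open>Neighbouring entries are the form in which prefix sums along a route obey a
  recurrence.\<close>

lemma consecutive_induct:
  assumes "e \<in> set p"
    and hd: "P (hd p)"
    and step: "\<And>xs a b ys. p = xs @ a # b # ys \<Longrightarrow> P a \<Longrightarrow> P b"
  shows "P e"
proof -
  have "P (p ! i)" if "i < length p" for i
    using that
  proof (induction i)
    case 0
    then show ?case using hd by (simp add: hd_conv_nth)
  next
    case (Suc i)
    have "p = take i p @ p ! i # p ! Suc i # drop (Suc (Suc i)) p"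
      using Suc.prems id_take_nth_drop[of i p] Cons_nth_drop_Suc[of "Suc i" p] by simp
    then show ?case using Suc.IH Suc.prems step by (metis Suc_lessD)
  qed
  then show ?thesis using \<open>e \<in> set p\<close> by (metis in_set_conv_nth)
qed

context flow_dag
begin

lemma awalk_le: "awalk u p v \<Longrightarrow> u \<le> v"
  by (induction p arbitrary: u) (auto simp: awalk_simps intro!: less_imp_le[OF less_le_trans[OF arc_increasing]])

lemma awalk_arc_bounds: "awalk u p v \<Longrightarrow> a \<in> set p \<Longrightarrow> u \<le> tail G a \<and> head G a \<le> v"
proof (induction p arbitrary: u)
  case (Cons e es)
  from Cons.prems(1) have e: "e \<in> arcs G" "u = tail G e" and es: "awalk (head G e) es v"
    by (auto simp: awalk_simps)
  show ?case
  proof (cases "a = e")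
    case True
    with e awalk_le[OF es] show ?thesis by simp
  next
    case False
    with Cons es have "head G e \<le> tail G a \<and> head G a \<le> v" by auto
    with arc_increasing[OF e(1)] e(2) show ?thesis by (auto intro: order.trans less_imp_le)
  qed
qed simp

text \<open>Arcs increase in the vertex order, so the tail of the first arc lies strictly below all
  later vertices and no vertex repeats.\<close>

lemma awalk_imp_apath: "awalk u p v \<Longrightarrow> apath u p v"
proof (induction p arbitrary: u)
  case (Cons e es)
  from Cons.prems(1) have e: "e \<in> arcs G" "u = tail G e" and es: "awalk (head G e) es v"
    by (auto simp: awalk_simps)
  have "head G e \<le> w" if "w \<in> set (awalk_verts (head G e) es)" for w
    using awalk_decomp[OF es that] awalk_le by blast
  then show ?case
    using e Cons.IH[OF es] arc_increasing[OF e(1)] by (auto simp: apath_Cons_iff dest: leD)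
qed (simp add: apath_Nil_iff awalk_Nil_iff)

lemma route_iff_awalk: "route G s t p \<longleftrightarrow> awalk s p t"
  by (auto simp: route_def awalk_imp_apath awalkI_apath)

lemma awalk_split_bounds:
  assumes "awalk u (xs @ e # ys) v"
  shows "a \<in> set xs \<Longrightarrow> head G a \<le> tail G e" "a \<in> set ys \<Longrightarrow> head G e \<le> tail G a"
proof -
  have 1: "awalk u xs (tail G e)" "awalk (head G e) ys v"
    using assms by (auto simp: awalk_simps)
  show "a \<in> set xs \<Longrightarrow> head G a \<le> tail G e" using awalk_arc_bounds[OF 1(1)] by blast
  show "a \<in> set ys \<Longrightarrow> head G e \<le> tail G a" using awalk_arc_bounds[OF 1(2)] by blast
qed

text \<open>Counting multiplicities makes each new arc contribute additively, so the induction never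
  has to ask whether the arc occurred before. This is why the vector of a route conserves
  flow.\<close>

lemma awalk_count_balance:
  assumes "awalk u p w"
  shows "(\<Sum>e\<in>in_arcs G v. real (count_list p e)) - (\<Sum>e\<in>out_arcs G v. real (count_list p e))
    = of_bool (v = w) - of_bool (v = u)"
  using assms
proof (induction p arbitrary: u)
  case (Cons e es)
  from Cons.prems(1) have e: "e \<in> arcs G" "u = tail G e" and es: "awalk (head G e) es w"
    by (auto simp: awalk_simps)
  have cnt: "real (count_list (e # es) a) = real (count_list es a) + of_bool (e = a)" for a
    by simp
  have "(\<Sum>a\<in>in_arcs G v. of_bool (e = a)) = (of_bool (head G e = v) :: real)"
    "(\<Sum>a\<in>out_arcs G v. of_bool (e = a)) = (of_bool (tail G e = v) :: real)"
    using e(1) by (simp_all add: of_bool_def finite_in_arcs finite_out_arcs)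
  with Cons.IH[OF es] e(2) show ?case
    unfolding cnt sum.distrib by auto
qed (simp add: awalk_Nil_iff)

lemma inner_vertsD:
  assumes "v \<in> inner_verts G s t"
  shows "v \<in> verts G" "s < v" "v < t"
  using assms inner_between by (auto simp: inner_verts_def)

lemma in_arcs_source: "in_arcs G s = {}"
  using unique_source[OF source_in_verts] unfolding in_degree_def card_eq_0_iff
  by (meson finite_in_arcs)

lemma vert_bounds:
  assumes "v \<in> verts G"
  shows "s \<le> v" "v \<le> t"
proof -
  consider "v = s" | "v = t" | "v \<in> inner_verts G s t"
    using assms by (auto simp: inner_verts_def)
  then have "s \<le> v \<and> v \<le> t"
    using source_less_sink inner_between[of v] by cases auto
  then show "s \<le> v" "v \<le> t" by auto
qed

lemma tail_bounds: "e \<in> arcs G \<Longrightarrow> s \<le> tail G e \<and> tail G e < t"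
  using vert_bounds[of "tail G e"] vert_bounds[of "head G e"] arc_increasing[of e] by auto

lemma head_bounds: "e \<in> arcs G \<Longrightarrow> s < head G e \<and> head G e \<le> t"
  using vert_bounds[of "tail G e"] vert_bounds[of "head G e"] arc_increasing[of e] by auto

lemma tail_inner: "e \<in> arcs G \<Longrightarrow> tail G e \<noteq> s \<Longrightarrow> tail G e \<in> inner_verts G s t"
  using tail_bounds[of e] by (auto simp: inner_verts_def)

lemma head_inner: "e \<in> arcs G \<Longrightarrow> head G e \<noteq> t \<Longrightarrow> head G e \<in> inner_verts G s t"
  using head_bounds[of e] by (auto simp: inner_verts_def)

lemma sum_out_arcs:
  "finite S \<Longrightarrow> (\<Sum>u\<in>S. sum f (out_arcs G u)) = sum f {a \<in> arcs G. tail G a \<in> S}"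
  by (subst sum.group[of _ S "tail G" f, symmetric])
    (auto intro!: sum.cong arg_cong[where f = "sum f"])

lemma sum_in_arcs:
  "finite S \<Longrightarrow> (\<Sum>u\<in>S. sum f (in_arcs G u)) = sum f {a \<in> arcs G. head G a \<in> S}"
  by (subst sum.group[of _ S "head G" f, symmetric])
    (auto intro!: sum.cong arg_cong[where f = "sum f"])

text \<open>Arcs of \<open>D\<close> are followed backwards from \<open>v\<close>: the balance
  condition supplies the next one at each inner vertex, and the vertices decrease until
  \<open>s\<close> is reached. In the application \<open>D\<close> is the support of a flow.\<close>

lemma walk_from_source:
  assumes D: "D \<subseteq> arcs G"
    and bal: "\<And>v. v \<in> inner_verts G s t \<Longrightarrow> out_arcs G v \<inter> D \<noteq> {} \<Longrightarrow> in_arcs G v \<inter> D \<noteq> {}"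
    and "v = s \<or> in_arcs G v \<inter> D \<noteq> {}"
  shows "\<exists>p. awalk s p v \<and> set p \<subseteq> D"
  using assms(3)
proof (induction "card {w \<in> verts G. w < v}" arbitrary: v rule: less_induct)
  case less
  show ?case
  proof (cases "v = s")
    case True
    then show ?thesis using source_in_verts by (intro exI[of _ "[]"]) (simp add: awalk_Nil_iff)
  next
    case False
    then obtain e where "e \<in> in_arcs G v \<inter> D" using less.prems by blast
    then have e: "e \<in> D" "e \<in> arcs G" "head G e = v" by auto
    have lt: "tail G e < v" using arc_increasing e by blast
    have "tail G e = s \<or> in_arcs G (tail G e) \<inter> D \<noteq> {}"
    proof -
      have "e \<in> out_arcs G (tail G e) \<inter> D" using e by simp
      then show ?thesis using tail_inner[OF e(2)] bal by blast
    qed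
    moreover have "card {w \<in> verts G. w < tail G e} < card {w \<in> verts G. w < v}"
      using lt e(2) by (intro psubset_card_mono) (auto intro: tail_in_verts)
    ultimately obtain p where "awalk s p (tail G e)" "set p \<subseteq> D"
      using less.hyps by blast
    then have "awalk s (p @ [e]) v \<and> set (p @ [e]) \<subseteq> D"
      using e arc_implies_awalk[OF e(2)] by (auto intro: awalk_appendI simp del: awalk_append_iff)
    then show ?thesis by blast
  qed
qed

text \<open>Mirror image of \<open>walk_from_source\<close>, with the number of vertices above
  \<open>v\<close> as measure.\<close>

lemma walk_to_sink:
  assumes D: "D \<subseteq> arcs G"
    and bal: "\<And>v. v \<in> inner_verts G s t \<Longrightarrow> in_arcs G v \<inter> D \<noteq> {} \<Longrightarrow> out_arcs G v \<inter> D \<noteq> {}"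
    and "v = t \<or> out_arcs G v \<inter> D \<noteq> {}"
  shows "\<exists>p. awalk v p t \<and> set p \<subseteq> D"
  using assms(3)
proof (induction "card {w \<in> verts G. v < w}" arbitrary: v rule: less_induct)
  case less
  show ?case
  proof (cases "v = t")
    case True
    then show ?thesis using sink_in_verts by (intro exI[of _ "[]"]) (simp add: awalk_Nil_iff)
  next
    case False
    then obtain e where "e \<in> out_arcs G v \<inter> D" using less.prems by blast
    then have e: "e \<in> D" "e \<in> arcs G" "tail G e = v" by auto
    have lt: "v < head G e" using arc_increasing e by blast
    have "head G e = t \<or> out_arcs G (head G e) \<inter> D \<noteq> {}"
    proof -
      have "e \<in> in_arcs G (head G e) \<inter> D" using e by simp
      then show ?thesis using head_inner[OF e(2)] bal by blast
    qed
    moreover have "card {w \<in> verts G. head G e < w} < card {w \<in> verts G. v < w}"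
      using lt e(2) by (intro psubset_card_mono) (auto intro: head_in_verts)
    ultimately obtain p where "awalk (head G e) p t" "set p \<subseteq> D"
      using less.hyps by blast
    then have "awalk v (e # p) t \<and> set (e # p) \<subseteq> D"
      using e by (auto simp: awalk_Cons_iff)
    then show ?thesis by blast
  qed
qed

end

section \<open>The flow polytope\<close>

locale finite_flow_dag = flow_dag G s t
  for G :: "('v::linorder, 'e::finite) pre_digraph" and s t
begin

lemma flow_polytopeD:
  assumes "x \<in> flow_polytope G s t"
  shows "e \<notin> arcs G \<Longrightarrow> x $ e = 0" "0 \<le> x $ e"
    "v \<in> inner_verts G s t \<Longrightarrow> (\<Sum>e\<in>in_arcs G v. x $ e) = (\<Sum>e\<in>out_arcs G v. x $ e)"
    "(\<Sum>e\<in>out_arcs G s. x $ e) = 1"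
proof -
  show "e \<notin> arcs G \<Longrightarrow> x $ e = 0" "0 \<le> x $ e"
    using assms by (cases "e \<in> arcs G"; simp add: flow_polytope_def)+
qed (use assms in \<open>auto simp: flow_polytope_def\<close>)

text \<open>
  All arcs cross the cut between \<open>{u. u \<le> tail e}\<close> and its complement in the forward direction,
  so the arc \<open>e\<close> carries at most the total flow \<open>1\<close>.
\<close>

lemma flow_le_1:
  assumes x: "x \<in> flow_polytope G s t"
  shows "x $ e \<le> 1"
proof (cases "e \<in> arcs G")
  case False
  then show ?thesis using flow_polytopeD(1)[OF x] by simp
next
  case True
  define S where "S = {u \<in> verts G. u \<le> tail G e}"
  have fin: "finite S" by (simp add: S_def)
  have sS: "s \<in> S" using tail_bounds[OF True] source_in_verts by (simp add: S_def)
  have inner: "u \<in> inner_verts G s t" if "u \<in> S - {s}" for u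
    using that tail_bounds[OF True] by (auto simp: S_def inner_verts_def)
  let ?net = "\<lambda>u. (\<Sum>a\<in>out_arcs G u. x $ a) - (\<Sum>a\<in>in_arcs G u. x $ a)"
  have "?net u = 0" if "u \<in> S - {s}" for u
    using flow_polytopeD(3)[OF x inner[OF that]] by simp
  then have "(\<Sum>u\<in>S. ?net u) = ?net s"
    using fin sS by (simp add: sum.remove)
  then have 1: "(\<Sum>u\<in>S. ?net u) = 1"
    using flow_polytopeD(4)[OF x] in_arcs_source by simp
  define A where "A = {a \<in> arcs G. tail G a \<in> S}"
  define B where "B = {a \<in> arcs G. head G a \<in> S}"
  have AB: "B \<subseteq> A" "finite A"
    using arc_increasing by (auto simp: A_def B_def S_def intro: tail_in_verts less_imp_le[OF less_le_trans])
  have "1 = (\<Sum>a\<in>A. x $ a) - (\<Sum>a\<in>B. x $ a)"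
    using 1 sum_out_arcs[OF fin, of "\<lambda>a. x $ a"] sum_in_arcs[OF fin, of "\<lambda>a. x $ a"]
    by (simp add: sum_subtractf A_def B_def)
  also have "\<dots> = (\<Sum>a\<in>A - B. x $ a)"
    using AB by (simp add: sum_diff)
  also have "\<dots> \<ge> x $ e"
  proof (rule member_le_sum)
    show "e \<in> A - B" using True arc_increasing[OF True] by (auto simp: A_def B_def S_def)
  qed (use flow_polytopeD(2)[OF x] AB in auto)
  finally show ?thesis .
qed

lemma flow_polytope_polytope: "polytope (flow_polytope G s t)"
  unfolding polytope_eq_bounded_polyhedron
proof
  define out where "out v = (\<Sum>e\<in>out_arcs G v. axis e (1::real))" for v
  define inn where "inn v = (\<Sum>e\<in>in_arcs G v. axis e (1::real))" for v
  have out: "out v \<bullet> x = (\<Sum>e\<in>out_arcs G v. x $ e)" and inn: "inn v \<bullet> x = (\<Sum>e\<in>in_arcs G v. x $ e)"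
    for v x
    by (simp_all add: out_def inn_def inner_sum_left inner_axis')
  have eq: "flow_polytope G s t = (\<Inter>e\<in>- arcs G. {x. axis e 1 \<bullet> x = 0}) \<inter> (\<Inter>e\<in>arcs G. {x. axis e 1 \<bullet> x \<ge> 0})
      \<inter> (\<Inter>v\<in>inner_verts G s t. {x. (inn v - out v) \<bullet> x = 0}) \<inter> {x. out s \<bullet> x = 1}"
    by (auto simp: flow_polytope_def inner_axis' inner_diff_left out inn)
  have "finite (inner_verts G s t)" by (simp add: inner_verts_def)
  then show "polyhedron (flow_polytope G s t)"
    unfolding eq
    by (intro polyhedron_Int polyhedron_Inter)
      (auto intro: polyhedron_hyperplane polyhedron_halfspace_ge)
  have "flow_polytope G s t \<subseteq> cbox 0 1"
    using flow_polytopeD(2) flow_le_1 by (auto simp: mem_box_cart)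
  then show "bounded (flow_polytope G s t)"
    using bounded_cbox bounded_subset by blast
qed

lemma route_in_flow_polytope:
  assumes "route G s t p"
  shows "(\<chi> e. real (count_list p e)) \<in> flow_polytope G s t"
proof -
  have p: "awalk s p t" using assms by (simp add: route_iff_awalk)
  have "set p \<subseteq> arcs G" using p by (simp add: awalk_def)
  then have "count_list p e = 0" if "e \<notin> arcs G" for e
    using that by (auto simp: count_list_0_iff)
  moreover have "(\<Sum>e\<in>in_arcs G v. real (count_list p e)) = (\<Sum>e\<in>out_arcs G v. real (count_list p e))"
    if "v \<in> inner_verts G s t" for v
    using awalk_count_balance[OF p, of v] that by (simp add: inner_verts_def)
  moreover have "(\<Sum>e\<in>out_arcs G s. real (count_list p e)) = 1"
    using awalk_count_balance[OF p, of s] in_arcs_source less_imp_neq[OF source_less_sink] by simp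
  ultimately show ?thesis by (simp add: flow_polytope_def)
qed

end


section \<open>Route decompositions\<close>

locale decomposed_dag = finite_flow_dag G s t
  for G :: "('v::{finite,linorder}, 'e::finite) pre_digraph" and s t +
  fixes R :: "'l::finite \<Rightarrow> 'e list"
  assumes decomposition: "route_decomposition G s t R"
begin

lemma awalk_R: "awalk s (R l) t"
  using decomposition by (simp add: route_decomposition_def route_iff_awalk)

lemma R_nonempty: "R l \<noteq> []"
  using awalk_R[of l] source_less_sink by (auto simp: awalk_Nil_iff)

lemma distinct_R: "distinct (R l)"
proof -
  have "distinct (awalk_verts s (R l))"
    using awalk_imp_apath[OF awalk_R[of l]] by (simp add: apath_def)
  then show ?thesis
    using R_nonempty[of l] by (simp add: awalk_verts_conv distinct_map)
qed

lemma R_arcs: "e \<in> set (R l) \<Longrightarrow> e \<in> arcs G"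
  using decomposition by (auto simp: route_decomposition_def)

lemma arc_in_R: "e \<in> arcs G \<Longrightarrow> \<exists>l. e \<in> set (R l)"
  using decomposition by (auto simp: route_decomposition_def)

lemma label_eq: "e \<in> set (R l) \<Longrightarrow> label R e = l"
  unfolding label_def
  using decomposition
  by (intro the_equality) (auto simp: route_decomposition_def disjoint_family_on_def)

lemma label_in: "e \<in> arcs G \<Longrightarrow> e \<in> set (R (label R e))"
  using arc_in_R label_eq by blast

lemma sum_routes: "(\<Sum>l\<in>UNIV. \<Sum>e\<in>set (R l). f e) = (\<Sum>e\<in>arcs G. f e)"
proof -
  have "(\<Sum>l\<in>UNIV. sum f (set (R l))) = sum f (\<Union>l. set (R l))"
    using decomposition
    by (intro sum.UNION_disjoint[symmetric]) (auto simp: route_decomposition_def disjoint_family_on_def)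
  then show ?thesis using decomposition by (simp add: route_decomposition_def)
qed

lemma R_split_bounds:
  assumes "R l = xs @ e # ys"
  shows "a \<in> set xs \<Longrightarrow> head G a \<le> tail G e" "a \<in> set ys \<Longrightarrow> head G e \<le> tail G a"
  using awalk_split_bounds[of s xs e ys t] awalk_R[of l] assms by auto

lemma head_inj_R: "inj_on (head G) (set (R l))"
proof
  fix a b assume ab: "a \<in> set (R l)" "b \<in> set (R l)" "head G a = head G b"
  obtain xs ys where R: "R l = xs @ a # ys" using split_list[OF ab(1)] by blast
  then consider "b \<in> set xs" | "b = a" | "b \<in> set ys" using ab(2) by auto
  then show "a = b"
  proof cases
    case 1
    with R_split_bounds(1)[OF R 1] ab arc_increasing[OF R_arcs[OF ab(1)]] show ?thesis by simp
  next
    case 3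
    with R_split_bounds(2)[OF R 3] ab arc_increasing[OF R_arcs[OF ab(2)]] show ?thesis by simp
  qed simp
qed

lemma tail_inj_R: "inj_on (tail G) (set (R l))"
proof
  fix a b assume ab: "a \<in> set (R l)" "b \<in> set (R l)" "tail G a = tail G b"
  obtain xs ys where R: "R l = xs @ a # ys" using split_list[OF ab(1)] by blast
  then consider "b \<in> set xs" | "b = a" | "b \<in> set ys" using ab(2) by auto
  then show "a = b"
  proof cases
    case 1
    with R_split_bounds(1)[OF R 1] ab arc_increasing[OF R_arcs[OF ab(2)]] show ?thesis by simp
  next
    case 3
    with R_split_bounds(2)[OF R 3] ab arc_increasing[OF R_arcs[OF ab(1)]] show ?thesis by simp
  qed simp
qed

lemma R_consecutive:
  assumes "R l = xs @ a # b # ys"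
  shows "head G a = tail G b"
  using awalk_R[of l] unfolding assms by (auto simp: awalk_simps)

lemma tail_hd_R: "tail G (hd (R l)) = s"
  using awalk_R[of l] R_nonempty[of l] by (cases "R l") (auto simp: awalk_simps)

lemma R_hd_or_pred:
  assumes "b \<in> set (R l)"
  shows "b = hd (R l) \<or> (\<exists>xs a ys. R l = xs @ a # b # ys)"
proof -
  obtain us ys where R: "R l = us @ b # ys" using split_list[OF assms] by blast
  show ?thesis
  proof (cases us rule: rev_cases)
    case Nil
    with R show ?thesis by simp
  next
    case (snoc xs a)
    with R show ?thesis by auto
  qed
qed

lemma R_last_or_succ:
  assumes "a \<in> set (R l)"
  shows "head G a = t \<or> (\<exists>xs b ys. R l = xs @ a # b # ys)"
proof -
  obtain us ys where R: "R l = us @ a # ys" using split_list[OF assms] by blast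
  show ?thesis
  proof (cases ys)
    case Nil
    with R awalk_R[of l] show ?thesis by (auto simp: awalk_simps)
  next
    case (Cons b zs)
    with R show ?thesis by auto
  qed
qed

section \<open>Coordinates of the projection along a route\<close>

lemma level_vec_nth:
  "level_vec G s t i l $ v $ m = of_bool (i \<in> inner_verts G s t \<and> v = i \<and> m = l)"
  by (simp add: level_vec_def axis_def)

lemma level_map_nth:
  "level_map G s t R x $ v $ l = (if v \<in> inner_verts G s t
     then (\<Sum>e\<in>set (R l). x $ e * (of_bool (head G e = v) - of_bool (tail G e = v))) else 0)"
proof -
  let ?g = "\<lambda>e. x $ e * (of_bool (v \<in> inner_verts G s t \<and> head G e = v \<and> label R e = l)
     - of_bool (v \<in> inner_verts G s t \<and> tail G e = v \<and> label R e = l))"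
  have "level_map G s t R x $ v $ l = (\<Sum>e\<in>arcs G. ?g e)"
    by (simp add: level_map_def level_vec_nth) (intro sum.cong, auto)
  also have "\<dots> = (\<Sum>e\<in>set (R l). ?g e)"
    by (rule sum.mono_neutral_right) (use R_arcs label_in in auto)
  also have "\<dots> = (if v \<in> inner_verts G s t
     then (\<Sum>e\<in>set (R l). x $ e * (of_bool (head G e = v) - of_bool (tail G e = v))) else 0)"
    using label_eq by auto
  finally show ?thesis .
qed

text \<open>If no arc of \<open>R l\<close> enters the inner vertex \<open>v\<close>, none leaves it
  either: such an arc could not be the first of \<open>R l\<close>, and its predecessor would end at
  \<open>v\<close>.\<close>

lemma level_map_eq_0:
  assumes "\<not> (v \<in> inner_verts G s t \<and> l \<in> inlevel G R (arcs G) v)"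
  shows "level_map G s t R x $ v $ l = 0"
proof (cases "v \<in> inner_verts G s t")
  case True
  have h: "head G e \<noteq> v" if "e \<in> set (R l)" for e
  proof
    assume "head G e = v"
    with that label_eq[OF that] R_arcs[OF that] have "l \<in> inlevel G R (arcs G) v"
      unfolding inlevel_def by (intro image_eqI[of _ _ e]) auto
    with assms True show False by simp
  qed
  have "tail G e \<noteq> v" if e: "e \<in> set (R l)" for e
  proof
    assume v: "tail G e = v"
    then have "e \<noteq> hd (R l)" using tail_hd_R[of l] inner_vertsD(2)[OF True] by auto
    then obtain xs a ys where R: "R l = xs @ a # e # ys" using R_hd_or_pred[OF e] by blast
    then have "head G a = v" using R_consecutive[OF R] v by simp
    with h[of a] R show False by simp
  qed
  with h show ?thesis by (simp add: level_map_nth)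
qed (simp add: level_map_nth)

lemma consecutive_inner:
  assumes R: "R l = xs @ a # b # ys"
  shows "head G a \<in> inner_verts G s t"
proof (rule head_inner)
  have "a \<in> arcs G" "b \<in> arcs G" using R_arcs[of _ l] R by auto
  then show "a \<in> arcs G" "head G a \<noteq> t"
    using tail_bounds[of b] R_consecutive[OF R] by auto
qed

text \<open>Heads on a route are distinct, and so are tails, so along \<open>R l\<close> only
  \<open>a\<close> enters this vertex and only \<open>b\<close> leaves it.\<close>

lemma level_map_consecutive:
  assumes R: "R l = xs @ a # b # ys"
  shows "level_map G s t R x $ head G a $ l = x $ a - x $ b"
proof -
  have ab: "a \<in> set (R l)" "b \<in> set (R l)" using R by auto
  have eq: "tail G b = head G a" using R_consecutive[OF R] by simp
  have "(\<Sum>e\<in>set (R l). x $ e * (of_bool (head G e = head G a) - of_bool (tail G e = tail G b)))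
    = (\<Sum>e\<in>set (R l). (if e = a then x $ e else 0) - (if e = b then x $ e else 0))"
  proof (rule sum.cong)
    fix e assume e: "e \<in> set (R l)"
    have "head G e = head G a \<longleftrightarrow> e = a" "tail G e = tail G b \<longleftrightarrow> e = b"
      using inj_on_eq_iff[OF head_inj_R e ab(1)] inj_on_eq_iff[OF tail_inj_R e ab(2)] by auto
    then show "x $ e * (of_bool (head G e = head G a) - of_bool (tail G e = tail G b))
      = (if e = a then x $ e else 0) - (if e = b then x $ e else 0)" by simp
  qed simp
  also have "\<dots> = x $ a - x $ b"
    using ab by (simp add: sum_subtractf)
  finally show ?thesis
    using consecutive_inner[OF R] by (simp add: level_map_nth eq)
qed

text \<open>This is \<open>S\<^sub>l(e, z)\<close> of the overview. The arc \<open>e\<close> itself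
  is excluded, so the value is 0 at the first arc of the route.\<close>

definition "prefix_sum l e z =
  (\<Sum>a\<in>set (takeWhile (\<lambda>e'. e' \<noteq> e) (R l)). z $ head G a $ l)"

lemma takeWhile_R:
  assumes "R l = xs @ e # ys"
  shows "takeWhile (\<lambda>e'. e' \<noteq> e) (R l) = xs"
proof -
  have "e \<notin> set xs" using distinct_R[of l] assms by auto
  then show ?thesis unfolding assms by (subst takeWhile_append2) auto
qed

lemma prefix_sum_hd: "prefix_sum l (hd (R l)) z = 0"
  using takeWhile_R[of l "[]" "hd (R l)" "tl (R l)"] R_nonempty[of l] by (simp add: prefix_sum_def)

lemma prefix_sum_consecutive:
  assumes R: "R l = xs @ a # b # ys"
  shows "prefix_sum l b z = prefix_sum l a z + z $ head G a $ l"
proof -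
  have R': "R l = (xs @ [a]) @ b # ys" using R by simp
  have "a \<notin> set xs" using distinct_R[of l] R by simp
  then show ?thesis
    unfolding prefix_sum_def takeWhile_R[OF R] takeWhile_R[OF R'] by (simp add: add.commute)
qed

lemma prefix_sum_level_map:
  assumes "e \<in> set (R l)"
  shows "prefix_sum l e (level_map G s t R x) = x $ hd (R l) - x $ e"
  using assms
proof (rule consecutive_induct)
  fix xs a b ys
  assume R: "R l = xs @ a # b # ys"
    and "prefix_sum l a (level_map G s t R x) = x $ hd (R l) - x $ a"
  then show "prefix_sum l b (level_map G s t R x) = x $ hd (R l) - x $ b"
    by (simp add: prefix_sum_consecutive[OF R] level_map_consecutive[OF R])
qed (simp add: prefix_sum_hd)

section \<open>Left sums as sums of prefix sums\<close>

lemma chosen_arc_range: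
  assumes "\<And>l. c l \<in> set (R l)"
  shows "chosen_arc R (range c) l = c l"
  unfolding chosen_arc_def
proof (rule the_equality)
  fix e assume e: "e \<in> range c \<and> e \<in> set (R l)"
  then obtain m where m: "e = c m" by blast
  then have "m = l" using label_eq[of e m] label_eq[of e l] assms[of m] e by simp
  with m show "e = c l" by simp
qed (use assms in simp)

text \<open>A choice function \<open>c\<close> for the transversal splits the functional into one
  term per route. The heads of the arcs before \<open>c l\<close> are distinct inner vertices, so
  the sum over vertices and labels becomes a sum over these arcs.\<close>

lemma left_sum_eq:
  assumes c: "\<And>l. c l \<in> set (R l)"
  shows "left_sum G s t R (range c) z = (\<Sum>l\<in>UNIV. prefix_sum l (c l) z)"
proof -
  have "left_sum G s t R (range c) z
    = (\<Sum>r\<in>UNIV. \<Sum>i\<in>inner_verts G s t. \<Sum>l\<in>inlevel G R (left_arcs R (range c) r) i. z $ i $ l)"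
    unfolding left_sum_def by (rule sum.swap)
  also have "\<dots> = (\<Sum>r\<in>UNIV. prefix_sum r (c r) z)"
  proof (rule sum.cong)
    fix r
    define L where "L = left_arcs R (range c) r"
    have L: "L = set (takeWhile (\<lambda>e. e \<noteq> c r) (R r))"
      by (simp add: L_def left_arcs_def chosen_arc_range[OF c])
    have LR: "L \<subseteq> set (R r)" unfolding L by (auto dest: set_takeWhileD)
    \<comment> \<open>An arc before \<open>c r\<close> ends no later than the tail of
      \<open>c r\<close>, which is below the sink.\<close>
    have "head G ` L \<subseteq> inner_verts G s t"
    proof
      fix v assume "v \<in> head G ` L"
      then obtain a where a: "a \<in> L" "v = head G a" by blast
      obtain xs ys where R: "R r = xs @ c r # ys" using split_list[OF c] by blast
      have "a \<in> set xs" using a(1) unfolding L takeWhile_R[OF R] .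
      then have "head G a \<le> tail G (c r)" by (rule R_split_bounds(1)[OF R])
      with tail_bounds[OF R_arcs[OF c, of r]] have "head G a \<noteq> t" by auto
      with a LR show "v \<in> inner_verts G s t" using head_inner R_arcs by blast
    qed
    have inl: "inlevel G R L i = (if i \<in> head G ` L then {r} else {})" for i
      using label_eq LR R_arcs unfolding inlevel_def by force
    have "(\<Sum>i\<in>inner_verts G s t. \<Sum>l\<in>inlevel G R L i. z $ i $ l)
      = (\<Sum>i\<in>inner_verts G s t. if i \<in> head G ` L then z $ i $ r else 0)"
      unfolding inl by (rule sum.cong) auto
    also have "\<dots> = (\<Sum>i\<in>head G ` L. z $ i $ r)"
      using \<open>head G ` L \<subseteq> inner_verts G s t\<close>
      by (simp add: sum.inter_restrict[symmetric] Int_absorb1)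
    also have "\<dots> = prefix_sum r (c r) z"
      unfolding prefix_sum_def L[symmetric]
      by (subst sum.reindex) (auto intro: inj_on_subset[OF head_inj_R LR])
    finally show "(\<Sum>i\<in>inner_verts G s t. \<Sum>l\<in>inlevel G R (left_arcs R (range c) r) i. z $ i $ l)
      = prefix_sum r (c r) z" unfolding L_def .
  qed simp
  finally show ?thesis .
qed

text \<open>Tails on a route are distinct, so the only arc of \<open>R l\<close> that leaves
  \<open>s\<close> is its first one.\<close>

lemma sum_out_arcs_source: "(\<Sum>e\<in>out_arcs G s. f e) = (\<Sum>l\<in>UNIV. f (hd (R l)))"
proof -
  have "inj (\<lambda>l. hd (R l))"
    by (rule injI) (metis label_eq hd_in_set R_nonempty)
  moreover have "out_arcs G s = range (\<lambda>l. hd (R l))"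
  proof (intro equalityI subsetI)
    fix e assume e: "e \<in> out_arcs G s"
    then obtain l where l: "e \<in> set (R l)" using arc_in_R by auto
    have "hd (R l) \<in> set (R l)" using R_nonempty by simp
    moreover have "tail G e = tail G (hd (R l))" using e tail_hd_R by simp
    ultimately have "e = hd (R l)" using tail_inj_R l by (metis inj_onD)
    then show "e \<in> range (\<lambda>l. hd (R l))" by blast
  qed (use R_arcs[OF hd_in_set[OF R_nonempty]] tail_hd_R in auto)
  ultimately show ?thesis by (simp add: sum.reindex)
qed

text \<open>Summing over labels reassembles all arcs, which turns flow conservation at
  \<open>v\<close> into the zero-sum equation there.\<close>

lemma sum_level_map:
  assumes "v \<in> inner_verts G s t"
  shows "(\<Sum>l\<in>UNIV. level_map G s t R x $ v $ l)
    = (\<Sum>e\<in>in_arcs G v. x $ e) - (\<Sum>e\<in>out_arcs G v. x $ e)"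
proof -
  have "(\<Sum>l\<in>UNIV. level_map G s t R x $ v $ l)
    = (\<Sum>e\<in>arcs G. x $ e * (of_bool (head G e = v) - of_bool (tail G e = v)))"
    using assms by (simp add: level_map_nth sum_routes)
  also have "\<dots> = (\<Sum>e\<in>arcs G. x $ e * of_bool (head G e = v)) - (\<Sum>e\<in>arcs G. x $ e * of_bool (tail G e = v))"
    by (simp only: right_diff_distrib sum_subtractf)
  finally show ?thesis
    by (simp add: in_arcs_def out_arcs_def Collect_conj_eq)
qed

section \<open>The zero-sum space\<close>

lemma zero_sum_space_iff:
  "z \<in> zero_sum_space G s t R \<longleftrightarrow>
    (\<forall>i l. \<not> (i \<in> inner_verts G s t \<and> l \<in> inlevel G R (arcs G) i) \<longrightarrow> z $ i $ l = 0) \<and>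
    (\<forall>i \<in> inner_verts G s t. (\<Sum>l\<in>UNIV. z $ i $ l) = 0)"
proof -
  have "(\<Sum>l\<in>inlevel G R (arcs G) i. z $ i $ l) = (\<Sum>l\<in>UNIV. z $ i $ l)"
    if "z \<in> level_space G s t R" for i
    using that by (intro sum.mono_neutral_left) (auto simp: level_space_def)
  then show ?thesis by (auto simp: zero_sum_space_def level_space_def)
qed

lemma subspace_zero_sum_space: "subspace (zero_sum_space G s t R)"
  by (rule subspaceI)
    (auto simp: zero_sum_space_iff sum.distrib sum_distrib_left[symmetric])

lemma level_map_in_zero_sum_space:
  assumes "x \<in> flow_polytope G s t"
  shows "level_map G s t R x \<in> zero_sum_space G s t R"
  using flow_polytopeD(3)[OF assms] by (simp add: zero_sum_space_iff level_map_eq_0 sum_level_map)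

text \<open>
  The sum along the part of a route before its chosen arc telescopes, and the first arcs of the
  routes are the arcs leaving the source.
\<close>

lemma left_sum_level_map:
  assumes "x \<in> flow_polytope G s t" and c: "\<And>l. c l \<in> set (R l)"
  shows "left_sum G s t R (range c) (level_map G s t R x) = 1 - (\<Sum>l\<in>UNIV. x $ c l)"
  using flow_polytopeD(4)[OF assms(1)]
  by (simp add: left_sum_eq[OF c] prefix_sum_level_map[OF c] sum_subtractf sum_out_arcs_source)

section \<open>The inequality description of the projected polytope\<close>

lemma linear_left_sum: "transversal R M \<Longrightarrow> linear (left_sum G s t R M)"
  unfolding left_sum_def
  by (rule linearI) (simp_all add: sum.distrib sum_distrib_left)

text \<open>\<open>a l\<close> prescribes the flow on the first arc of \<open>R l\<close>, and
  \<open>z\<close> then determines it on the rest of the route. The bounds on prefix sums give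
  nonnegativity, the sum of the \<open>a l\<close> is the total flow, and conservation comes from
  the zero sums of \<open>z\<close>.\<close>

lemma flow_with_given_level_map:
  assumes z: "z \<in> zero_sum_space G s t R"
    and a: "\<And>l e. e \<in> set (R l) \<Longrightarrow> prefix_sum l e z \<le> a l" "(\<Sum>l\<in>UNIV. a l) = 1"
  shows "\<exists>x \<in> flow_polytope G s t. level_map G s t R x = z"
proof -
  define x :: "real ^ 'e" where
    "x = (\<chi> e. if e \<in> arcs G then a (label R e) - prefix_sum (label R e) e z else 0)"
  have x: "x $ e = a l - prefix_sum l e z" if "e \<in> set (R l)" for e l
    using that R_arcs[OF that] label_eq[OF that] by (simp add: x_def)
  have eq: "level_map G s t R x $ v $ l = z $ v $ l" for v l
  proof (cases "v \<in> inner_verts G s t \<and> l \<in> inlevel G R (arcs G) v")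
    case True
    then obtain e where e: "e \<in> arcs G" "head G e = v" "label R e = l"
      by (auto simp: inlevel_def)
    then have "e \<in> set (R l)" using label_in by blast
    \<comment> \<open>An arc into an inner vertex is not the last of its route, so the coordinate is
      a difference of flows on neighbouring arcs.\<close>
    moreover have "head G e \<noteq> t" using True inner_vertsD(3)[of v] e by auto
    ultimately obtain xs b ys where R: "R l = xs @ e # b # ys" using R_last_or_succ by blast
    then have "e \<in> set (R l)" "b \<in> set (R l)" by auto
    then have "level_map G s t R x $ head G e $ l = z $ head G e $ l"
      unfolding level_map_consecutive[OF R] by (simp add: x prefix_sum_consecutive[OF R])
    then show ?thesis using e by simp
  next
    case False
    then show ?thesis using z level_map_eq_0[OF False] by (simp add: zero_sum_space_iff)
  qed
  have "x \<in> flow_polytope G s t"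
    unfolding flow_polytope_def
  proof (intro CollectI conjI allI ballI impI)
    show "x $ e = 0" if "e \<notin> arcs G" for e using that by (simp add: x_def)
    show "0 \<le> x $ e" if "e \<in> arcs G" for e
      using x[OF label_in[OF that]] a(1)[OF label_in[OF that]] by simp
    show "(\<Sum>e\<in>in_arcs G v. x $ e) = (\<Sum>e\<in>out_arcs G v. x $ e)" if v: "v \<in> inner_verts G s t" for v
      using sum_level_map[OF v, of x] z v unfolding eq by (simp add: zero_sum_space_iff)
    show "(\<Sum>e\<in>out_arcs G s. x $ e) = 1"
      using a(2) x[OF hd_in_set[OF R_nonempty]] by (simp add: sum_out_arcs_source prefix_sum_hd)
  qed
  moreover have "level_map G s t R x = z" by (simp add: vec_eq_iff eq)
  ultimately show ?thesis by blast
qed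

text \<open>For the inclusion from right to left, an arc with the largest prefix sum is picked on
  every route: the inequality of this single transversal already leaves room for the starting values
  of a nonnegative preimage.\<close>

lemma Q_polytope_eq:
  "Q_polytope G s t R =
    {z \<in> zero_sum_space G s t R. \<forall>M \<in> {M. transversal R M}. left_sum G s t R M z \<le> 1}"
proof (intro equalityI subsetI)
  fix z assume "z \<in> Q_polytope G s t R"
  then obtain x where x: "x \<in> flow_polytope G s t" "z = level_map G s t R x"
    by (auto simp: Q_polytope_def)
  have "left_sum G s t R M z \<le> 1" if M: "transversal R M" for M
  proof -
    obtain c where c: "\<And>l. c l \<in> set (R l)" and "M = range c"
      using M by (auto simp: transversal_def)
    have "0 \<le> (\<Sum>l\<in>UNIV. x $ c l)" using flow_polytopeD(2)[OF x(1)] by (simp add: sum_nonneg)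
    then show ?thesis
      using left_sum_level_map[OF x(1) c] by (simp add: x(2) \<open>M = range c\<close>)
  qed
  then show "z \<in> {z \<in> zero_sum_space G s t R. \<forall>M \<in> {M. transversal R M}. left_sum G s t R M z \<le> 1}"
    using level_map_in_zero_sum_space x by simp
next
  fix z assume "z \<in> {z \<in> zero_sum_space G s t R. \<forall>M \<in> {M. transversal R M}. left_sum G s t R M z \<le> 1}"
  then have z: "z \<in> zero_sum_space G s t R"
    and le: "\<And>M. transversal R M \<Longrightarrow> left_sum G s t R M z \<le> 1" by auto
  have "\<exists>c \<in> set (R l). \<forall>e \<in> set (R l). prefix_sum l e z \<le> prefix_sum l c z" for l
  proof -
    let ?A = "(\<lambda>e. prefix_sum l e z) ` set (R l)"
    have "finite ?A" "?A \<noteq> {}" using R_nonempty by auto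
    then have "Max ?A \<in> ?A" "\<forall>y\<in>?A. y \<le> Max ?A" by auto
    then show ?thesis by fastforce
  qed
  then obtain c where c: "\<And>l. c l \<in> set (R l)"
    and max: "\<And>l e. e \<in> set (R l) \<Longrightarrow> prefix_sum l e z \<le> prefix_sum l (c l) z"
    by metis
  \<comment> \<open>\<open>\<delta>\<close> shares the slack of this inequality equally among the
    routes, so that the starting values sum to exactly 1.\<close>
  define \<delta> where "\<delta> = (1 - (\<Sum>l\<in>UNIV. prefix_sum l (c l) z)) / real CARD('l)"
  have "transversal R (range c)" using c by (auto simp: transversal_def)
  then have "(\<Sum>l\<in>UNIV. prefix_sum l (c l) z) \<le> 1"
    using le left_sum_eq[OF c] by metis
  then have "\<delta> \<ge> 0" by (simp add: \<delta>_def)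
  have "\<exists>x \<in> flow_polytope G s t. level_map G s t R x = z"
  proof (rule flow_with_given_level_map[OF z])
    show "prefix_sum l e z \<le> prefix_sum l (c l) z + \<delta>" if "e \<in> set (R l)" for l e
      using max[OF that] \<open>\<delta> \<ge> 0\<close> by simp
    show "(\<Sum>l\<in>UNIV. prefix_sum l (c l) z + \<delta>) = 1"
      by (simp add: sum.distrib \<delta>_def)
  qed
  then show "z \<in> Q_polytope G s t R" by (auto simp: Q_polytope_def)
qed

lemma linear_level_map: "linear (level_map G s t R)"
  unfolding level_map_def
  by (rule linearI) (simp_all add: scaleR_add_left sum.distrib scaleR_sum_right)

section \<open>Flows that vanish on a transversal\<close>

lemma avoidableD:
  "avoidable G s t M \<Longrightarrow> v \<in> inner_verts G s t \<Longrightarrow>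
    \<exists>p. awalk s p t \<and> v \<in> set (awalk_verts s p) \<and> set p \<inter> M = {}"
  by (simp add: avoidable_def route_iff_awalk)

text \<open>The initial part of an avoiding route through the tail of \<open>e\<close>, the arc
  \<open>e\<close>, and the final part of one through its head are spliced; at the source or the
  sink the empty walk serves instead.\<close>

lemma route_avoiding_through_arc:
  assumes av: "avoidable G s t M" and e: "e \<in> arcs G - M"
  shows "\<exists>p. route G s t p \<and> e \<in> set p \<and> set p \<inter> M = {}"
proof -
  have through: "\<exists>p q. awalk s p v \<and> awalk v q t \<and> set (p @ q) \<inter> M = {}"
    if v: "v \<in> inner_verts G s t" for v
  proof -
    obtain r where r: "awalk s r t" "v \<in> set (awalk_verts s r)" "set r \<inter> M = {}"
      using avoidableD[OF av v] by blast
    show ?thesis using awalk_decomp[OF r(1,2)] r(3) by metis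
  qed
  have "\<exists>p. awalk s p (tail G e) \<and> set p \<inter> M = {}"
  proof (cases "tail G e = s")
    case True
    then show ?thesis using source_in_verts by (intro exI[of _ "[]"]) (simp add: awalk_Nil_iff)
  next
    case False
    then obtain p q where "awalk s p (tail G e)" "set (p @ q) \<inter> M = {}"
      using through tail_inner e by blast
    then show ?thesis by (intro exI[of _ p]) auto
  qed
  moreover have "\<exists>q. awalk (head G e) q t \<and> set q \<inter> M = {}"
  proof (cases "head G e = t")
    case True
    then show ?thesis using sink_in_verts by (intro exI[of _ "[]"]) (simp add: awalk_Nil_iff)
  next
    case False
    then obtain p q where "awalk (head G e) q t" "set (p @ q) \<inter> M = {}"
      using through head_inner e by blast
    then show ?thesis by (intro exI[of _ q]) auto
  qed
  ultimately obtain p q where pq: "awalk s p (tail G e)" "set p \<inter> M = {}"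
    "awalk (head G e) q t" "set q \<inter> M = {}" by blast
  have "awalk (tail G e) (e # q) t" using e pq(3) by (simp add: awalk_Cons_iff)
  then have "awalk s (p @ e # q) t" using pq(1) by (rule awalk_appendI[rotated])
  moreover have "set (p @ e # q) \<inter> M = {}" using pq e by auto
  ultimately show ?thesis unfolding route_iff_awalk by (intro exI[of _ "p @ e # q"]) auto
qed

lemma flow_supported_off_transversal:
  assumes av: "avoidable G s t M" and ne: "inner_verts G s t \<noteq> {}"
  shows "\<exists>x \<in> flow_polytope G s t. (\<forall>e \<in> M. x $ e = 0) \<and> (\<forall>e \<in> arcs G - M. x $ e > 0)"
proof -
  define A where "A = arcs G - M"
  obtain P where P: "\<And>e. e \<in> A \<Longrightarrow> route G s t (P e)" "\<And>e. e \<in> A \<Longrightarrow> e \<in> set (P e)"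
    "\<And>e. e \<in> A \<Longrightarrow> set (P e) \<inter> M = {}"
    using route_avoiding_through_arc[OF av] unfolding A_def by metis
  \<comment> \<open>The avoiding route through some inner vertex shows that \<open>A\<close> is
    nonempty, so that averaging over \<open>A\<close> makes sense.\<close>
  obtain v where "v \<in> inner_verts G s t" using ne by blast
  then obtain r where r: "awalk s r t" "set r \<inter> M = {}"
    using avoidableD[OF av] by blast
  have "r \<noteq> []" using r(1) source_less_sink by (auto simp: awalk_Nil_iff)
  then have "hd r \<in> A" using r hd_in_set[of r] unfolding A_def awalk_def by blast
  then have card: "card A > 0" by (auto simp: card_gt_0_iff)
  define x where "x = (\<Sum>e\<in>A. (1 / real (card A)) *\<^sub>R (\<chi> a. real (count_list (P e) a)))"
  have x: "x $ a = (\<Sum>e\<in>A. real (count_list (P e) a) / real (card A))" for a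
    by (simp add: x_def)
  have "x \<in> flow_polytope G s t"
    unfolding x_def
    by (rule convex_sum)
      (use card P(1) in \<open>auto simp: polytope_imp_convex flow_polytope_polytope route_in_flow_polytope\<close>)
  moreover have "x $ a = 0" if "a \<in> M" for a
  proof -
    have "count_list (P e) a = 0" if "e \<in> A" for e
      using P(3)[OF that] \<open>a \<in> M\<close> by (auto simp: count_list_0_iff)
    then show ?thesis by (simp add: x)
  qed
  moreover have "x $ a > 0" if "a \<in> arcs G - M" for a
  proof -
    have a: "a \<in> A" using that by (simp add: A_def)
    have "count_list (P a) a > 0" using P(2)[OF a] by (metis count_list_0_iff gr0I)
    then show ?thesis unfolding x using a card by (intro sum_pos2[of _ a]) auto
  qed
  ultimately show ?thesis by blast
qed

text \<open>The support of \<open>x\<close> misses \<open>M\<close>. Were an arc at \<open>v\<close>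
  in the support, it could be continued within the support in both directions, giving a route
  through \<open>v\<close> that avoids \<open>M\<close>.\<close>

lemma flow_vanishes_at_unavoidable:
  assumes x: "x \<in> flow_polytope G s t" and M: "\<And>e. e \<in> M \<Longrightarrow> x $ e = 0"
    and v: "v \<in> inner_verts G s t"
    and unavoidable: "\<And>p. route G s t p \<Longrightarrow> v \<in> set (awalk_verts s p) \<Longrightarrow> set p \<inter> M \<noteq> {}"
    and e: "e \<in> arcs G" "head G e = v \<or> tail G e = v"
  shows "x $ e = 0"
proof (rule ccontr)
  assume "x $ e \<noteq> 0"
  define D where "D = {e \<in> arcs G. x $ e > 0}"
  have D: "D \<subseteq> arcs G" by (auto simp: D_def)
  have eD: "e \<in> D" using e(1) \<open>x $ e \<noteq> 0\<close> flow_polytopeD(2)[OF x, of e] by (auto simp: D_def)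
  have pos: "(0 < (\<Sum>e\<in>B. x $ e)) \<longleftrightarrow> B \<inter> D \<noteq> {}" if "B \<subseteq> arcs G" for B
  proof
    assume "0 < (\<Sum>e\<in>B. x $ e)"
    then obtain b where "b \<in> B" "x $ b > 0" by (meson not_le sum_nonpos)
    then show "B \<inter> D \<noteq> {}" using that by (auto simp: D_def)
  next
    assume "B \<inter> D \<noteq> {}"
    then obtain b where "b \<in> B" "x $ b > 0" by (auto simp: D_def)
    then show "0 < (\<Sum>e\<in>B. x $ e)"
      using flow_polytopeD(2)[OF x] by (intro sum_pos2[of _ b]) auto
  qed
  \<comment> \<open>For a nonnegative flow, conservation makes positive inflow and positive outflow
    occur together; this is the balance that the walk lemmas ask for.\<close>
  have bal: "in_arcs G u \<inter> D \<noteq> {} \<longleftrightarrow> out_arcs G u \<inter> D \<noteq> {}" if "u \<in> inner_verts G s t" for u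
    using pos[of "in_arcs G u"] pos[of "out_arcs G u"] flow_polytopeD(3)[OF x that] by force
  have "e \<in> in_arcs G v \<inter> D \<or> e \<in> out_arcs G v \<inter> D"
    using eD e by simp
  then have "in_arcs G v \<inter> D \<noteq> {}" "out_arcs G v \<inter> D \<noteq> {}"
    using bal[OF v] by blast+
  then obtain p q where p: "awalk s p v" "set p \<subseteq> D" and q: "awalk v q t" "set q \<subseteq> D"
    using walk_from_source[OF D, of v] walk_to_sink[OF D, of v] bal by metis
  have "route G s t (p @ q)" using awalk_appendI[OF p(1) q(1)] by (simp only: route_iff_awalk)
  moreover have "v \<in> set (awalk_verts s (p @ q))"
    using set_awalk_verts_append[OF p(1) q(1)] hd_in_awalk_verts(1)[OF q(1)] by simp
  ultimately have "set (p @ q) \<inter> M \<noteq> {}" by (rule unavoidable)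
  then show False using p(2) q(2) M by (fastforce simp: D_def)
qed

text \<open>Without idle arcs at least two arcs enter \<open>v\<close>. Heads on a route being
  distinct, the two carry different labels, and the difference of their basis vectors serves as
  witness.\<close>

lemma zero_sum_space_nonzero_at:
  assumes v: "v \<in> inner_verts G s t" and no_idle: "\<forall>e \<in> arcs G. \<not> idle_arc G s t e"
  shows "\<exists>w \<in> zero_sum_space G s t R. w $ v \<noteq> 0"
proof -
  have "in_arcs G v \<noteq> {}"
    using unique_source[of v] inner_vertsD(1,2)[OF v] by (auto simp: in_degree_def)
  then obtain a where a: "a \<in> in_arcs G v" by blast
  then have "in_arcs G v \<noteq> {a}" using no_idle v by (auto simp: idle_arc_def)
  then obtain b where b: "b \<in> in_arcs G v" "b \<noteq> a" using a by blast
  have ab: "a \<in> arcs G" "head G a = v" "b \<in> arcs G" "head G b = v" using a b by auto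
  have ne: "label R a \<noteq> label R b"
    using inj_onD[OF head_inj_R[of "label R a"], of a b] label_in[OF ab(1)] label_in[OF ab(3)] ab b(2)
    by auto
  have inl: "label R a \<in> inlevel G R (arcs G) v" "label R b \<in> inlevel G R (arcs G) v"
    using a b ab by (auto simp: inlevel_def)
  define w where "w = axis v (axis (label R a) (1::real) - axis (label R b) 1)"
  have w: "w $ i $ l = of_bool (i = v \<and> l = label R a) - of_bool (i = v \<and> l = label R b)" for i l
    by (auto simp: w_def axis_def)
  have "(\<Sum>l\<in>UNIV. w $ i $ l) = 0" for i
    by (cases "i = v") (simp_all add: w sum_subtractf of_bool_def)
  then have "w \<in> zero_sum_space G s t R"
    using inl v by (auto simp: zero_sum_space_iff w)
  moreover have "w $ v \<noteq> 0"
    using w[of v "label R a"] ne by auto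
  ultimately show ?thesis by blast
qed

end

section \<open>Dimension and facets of the projected polytope\<close>

theorem theorem5p11:
  fixes G :: "('v::{finite,linorder}, 'e::finite) pre_digraph"
    and s t :: 'v
    and R :: "'l::{finite,linorder} \<Rightarrow> 'e list"
  assumes dag: "flow_dag G s t"
    and no_idle: "\<forall>e \<in> arcs G. \<not> idle_arc G s t e"
    and degree_eq: "degree_equality G s t"
    and decomposition: "route_decomposition G s t R"
  shows "polytope (Q_polytope G s t R)
    \<and> Q_polytope G s t R \<subseteq> zero_sum_space G s t R
    \<and> aff_dim (Q_polytope G s t R) = int (dim (zero_sum_space G s t R))
    \<and> (\<forall>M. transversal R M \<and> avoidable G s t M \<longrightarrow>
         Q_polytope G s t R \<subseteq> halfspace_M G s t R M)
    \<and> (inner_verts G s t \<noteq> {} \<longrightarrow>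
         bij_betw (\<lambda>M. Q_polytope G s t R \<inter> hyperplane_M G s t R M)
           {M. transversal R M \<and> avoidable G s t M}
           {F. F facet_of Q_polytope G s t R})"
proof -
  interpret flow_dag G s t by (rule dag)
  interpret decomposed_dag G s t R by unfold_locales (rule decomposition)
  let ?Q = "Q_polytope G s t R" and ?Z = "zero_sum_space G s t R"
  interpret Q: polar_polyhedron ?Z "{M. transversal R M}" "left_sum G s t R"
    by (rule polar_polyhedron.intro) (simp_all add: subspace_zero_sum_space linear_left_sum)
  have Q: "?Q = Q.polar" by (simp add: Q_polytope_eq Q.polar_def)
  have QZ: "?Q \<subseteq> ?Z" using Q.polarD(1) by (auto simp: Q)
  have ZV: "?Z \<subseteq> level_space G s t R" by (auto simp: zero_sum_space_def)
  have face: "?Q \<inter> hyperplane_M G s t R M = Q.face M" for M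
    using QZ ZV unfolding Q by (auto simp: Q.face_def hyperplane_M_def)
  have "polytope ?Q"
    unfolding Q_polytope_def
    by (rule polytope_linear_image[OF linear_level_map flow_polytope_polytope])
  moreover have "aff_dim ?Q = int (dim ?Z)" by (simp only: Q Q.aff_dim_polar)
  moreover have "?Q \<subseteq> halfspace_M G s t R M" if "transversal R M" for M
    using QZ ZV Q.polarD(2)[of _ M] that unfolding Q by (auto simp: halfspace_M_def)
  \<comment> \<open>Without inner vertices the only transversal is the whole arc set; it is
    vacuously avoidable, yet the polytope is a single point and has no facet. Hence the assumption
    \<open>ne\<close>.\<close>
  moreover have "bij_betw Q.face {M. transversal R M \<and> avoidable G s t M} {F. F facet_of Q.polar}"
    if ne: "inner_verts G s t \<noteq> {}"
  proof (rule Q.bij_betw_facets)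
    fix M assume "M \<in> {M. transversal R M \<and> avoidable G s t M}"
    then have M: "transversal R M" "avoidable G s t M" by auto
    obtain c where c: "\<And>l. c l \<in> set (R l)" and Mc: "M = range c"
      using M(1) by (auto simp: transversal_def)
    obtain x where x: "x \<in> flow_polytope G s t" "\<And>e. e \<in> M \<Longrightarrow> x $ e = 0"
      "\<And>e. e \<in> arcs G \<Longrightarrow> e \<notin> M \<Longrightarrow> x $ e > 0"
      using flow_supported_off_transversal[OF M(2) ne] by auto
    show "\<exists>p \<in> Q.face M. \<forall>M' \<in> {M. transversal R M} - {M}. left_sum G s t R M' p < 1"
    proof (intro bexI ballI)
      have "level_map G s t R x \<in> ?Q" using x(1) by (auto simp: Q_polytope_def)
      moreover have "left_sum G s t R M (level_map G s t R x) = 1"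
        using left_sum_level_map[OF x(1) c] x(2) by (simp add: Mc)
      ultimately show "level_map G s t R x \<in> Q.face M" by (simp add: Q Q.face_def)
    next
      fix M' assume M': "M' \<in> {M. transversal R M} - {M}"
      then obtain c' where c': "\<And>l. c' l \<in> set (R l)" and Mc': "M' = range c'"
        by (auto simp: transversal_def)
      have "c' \<noteq> c" using M' Mc Mc' by auto
      then obtain l where l: "c' l \<noteq> c l" by blast
      \<comment> \<open>The arcs that \<open>c\<close> chooses on other routes have other labels, so
        \<open>c' l\<close> lies outside all of \<open>M\<close> and carries positive flow.\<close>
      have "c' l \<noteq> c m" for m
        using l label_eq[OF c'[of l]] label_eq[OF c[of m]] by auto
      then have "c' l \<notin> M" by (auto simp: Mc)
      then have "x $ c' l > 0" using x(3) R_arcs[OF c'] by blast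
      then have "(\<Sum>l\<in>UNIV. x $ c' l) > 0"
        using flow_polytopeD(2)[OF x(1)] by (intro sum_pos2[of _ l]) auto
      then show "left_sum G s t R M' (level_map G s t R x) < 1"
        using left_sum_level_map[OF x(1) c'] by (simp add: Mc')
    qed
  next
    fix M assume "M \<in> {M. transversal R M} - {M. transversal R M \<and> avoidable G s t M}"
    then have M: "transversal R M" and "\<not> avoidable G s t M" by auto
    then obtain v where v: "v \<in> inner_verts G s t"
      and un: "\<And>p. route G s t p \<Longrightarrow> v \<in> set (awalk_verts s p) \<Longrightarrow> set p \<inter> M \<noteq> {}"
      by (auto simp: avoidable_def)
    obtain c where c: "\<And>l. c l \<in> set (R l)" and Mc: "M = range c"
      using M by (auto simp: transversal_def)
    let ?W = "{z. z $ v = 0}"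
    have "subspace ?W" by (rule subspaceI) auto
    moreover have "\<not> ?Z \<subseteq> ?W" using zero_sum_space_nonzero_at[OF v no_idle] by auto
    moreover have "Q.face M \<subseteq> ?W"
    proof
      fix z assume "z \<in> Q.face M"
      then have zQ: "z \<in> ?Q" and z1: "left_sum G s t R M z = 1" by (auto simp: Q Q.face_def)
      then obtain x where x: "x \<in> flow_polytope G s t" and z: "z = level_map G s t R x"
        by (auto simp: Q_polytope_def)
      \<comment> \<open>Tightness says that the total flow on \<open>M\<close> is 0; by
        nonnegativity it vanishes on each arc of \<open>M\<close>.\<close>
      have "(\<Sum>l\<in>UNIV. x $ c l) = 0" using left_sum_level_map[OF x c] z1 by (simp add: z Mc)
      then have "x $ e = 0" if "e \<in> M" for e
        using that flow_polytopeD(2)[OF x] by (auto simp: sum_nonneg_eq_0_iff Mc)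
      then have "x $ e = 0" if "e \<in> arcs G" "head G e = v \<or> tail G e = v" for e
        using flow_vanishes_at_unavoidable[OF x _ v un that] by blast
      then have "level_map G s t R x $ v $ l = 0" for l
        using R_arcs by (auto simp: level_map_nth intro!: sum.neutral)
      then show "z \<in> ?W" by (simp add: z vec_eq_iff)
    qed
    ultimately show "\<exists>W. subspace W \<and> \<not> ?Z \<subseteq> W \<and> Q.face M \<subseteq> W" by blast
  qed auto
  ultimately show ?thesis using QZ unfolding face unfolding Q by blast
qed

end
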